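(* Let $\mathcal{X}$ be a cell complex which is embeddable into the $n$-dimensional hypercube complex $\mathcal{H}_n$, with incidence embedding $\iota\colon\mathcal{X}\to\mathcal{H}_n$. For any $1\leq i\leq n$, the function $\alpha_i\colon\mathcal{X}\to\mathcal{X}$ defined by $$\alpha_i(\xi)=\begin{cases}\iota^{-1}(\mathcal{M}_i(\iota(\xi))) & \text{if } \mathcal{M}_i(\iota(\xi))\in\iota(\mathcal{X}),\\ \xi & \text{otherwise,}\end{cases}$$ is an acyclic partial matching on $\mathcal{X}$. Moreover, the function $w\colon\mathcal{X}\to\mathcal{X}$ given by $w(\cdot):=\mathrm{Mate}(\cdot,\boldsymbol{\alpha})$, where $\boldsymbol{\alpha}=(\alpha_1,\alpha_2,\ldots,\alpha_n)$, is an acyclic partial matching on $\mathcal{X}$.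
   Context: **Cell complex.** Let $\mathbb{K}$ be a field. A cell complex (over $\mathbb{K}$) $(\mathcal{X},\leq,\kappa,\dim)$ is a finite poset $(\mathcal{X},\leq)$ together with functions $\dim\colon\mathcal{X}\to\mathbb{N}$ and $\kappa\colon\mathcal{X}\times\mathcal{X}\to\mathbb{K}$ such that: (1) $\xi\leq\xi'$ implies $\dim\xi\leq\dim\xi'$; (2) $\kappa(\xi,\xi')\neq 0$ implies $\xi'\leq\xi$ and $\dim\xi=\dim\xi'+1$; (3) for all $\xi,\xi''\in\mathcal{X}$, $\sum_{\xi'\in\mathcal{X}}\kappa(\xi,\xi')\kappa(\xi',\xi'')=0$. The incidence relation $\prec$ on $\mathcal{X}$ is: $\xi'\prec\xi$ iff $\kappa(\xi,\xi')\neq 0$. **Incidence embedding.** For cell complexes $\mathcal{X},\mathcal{X}'$ (possibly over different fields), an incidence embedding $\iota\colon\mathcal{X}\to\mathcal{X}'$ is an injective map such that for all $\xi,\xi'\in\mathcal{X}$: $\xi'\prec\xi$ iff $\iota(\xi')\prec\iota(\xi)$. If one exists, $\mathcal{X}$ is said to be embeddable into $\mathcal{X}'$. **Hypercube complex.** For $n\geq1$, $\mathcal{H}_n$ is the cell complex over $\mathbb{Z}_2$ with set of cells $\mathbb{Z}_2^n=\{0,1\}^n$, product partial order ($\mathbf{x}'\leq\mathbf{x}$ iff $x'_i\leq x_i$ for all $i$, with $0\leq1$), $\dim(\mathbf{x})=\sum_i x_i$ (integer sum), and $\kappa(\mathbf{x},\mathbf{x}')=1$ if $\mathbf{x}'\leq\mathbf{x}$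 and $\dim\mathbf{x}'=\dim\mathbf{x}-1$, and $\kappa(\mathbf{x},\mathbf{x}')=0$ otherwise. For $1\leq i\leq n$ the template $\mathcal{M}_i\colon\mathcal{H}_n\to\mathcal{H}_n$ is $\mathcal{M}_i(\mathbf{x})=\mathbf{x}+\mathbf{e}_i$ (addition mod 2), where $\mathbf{e}_i$ is the $i$-th standard unit vector; i.e. $\mathcal{M}_i$ flips the $i$-th bit. **(Acyclic) partial matching.** A partial matching of $\mathcal{X}$ is an involution $w\colon\mathcal{X}\to\mathcal{X}$ such that for every $\xi$: $w(\xi)=\xi$, or $\xi\prec w(\xi)$, or $w(\xi)\prec\xi$. Put $Q(w)=\{\xi\mid\xi\prec w(\xi)\}$ and, for $\xi_0,\xi_1\in Q(w)$, let $\xi_1\ll\xi_0$ iff $\xi_1\prec w(\xi_0)$. The partial matching $w$ is acyclic if the transitive closure of $\ll$ is a partial order on $Q(w)$. **The algorithm Mate.** For a sequence $\mathbf{w}=(w_1,\ldots,w_n)$ of partial matchings on $\mathcal{X}$, $\mathrm{Mate}(\xi,\mathbf{w})$ returns $\mathrm{MateHelper}(\xi,n,\mathbf{w})$, where $\mathrm{MateHelper}(\xi,i,\mathbf{w})$ is the recursive procedure: - if $i=0$, return $\xi$; - otherwise set $\xi':=\mathrm{MateHelper}(\xi,i-1,\mathbf{w})$; - if $\xi'=\xi$ and $\mathrm{MateHelper}(w_i(\xi),i-1,\mathbf{w})=w_i(\xi)$, return $w_i(\xi)$; - otherwise return $\xi'$. *)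

theory Defs
  imports Complex_Main "HOL-Library.Z2" "HOL-Library.FuncSet"
begin

record ('a, 'k) cell_structure =
  cells :: "'a set"
  le :: "'a rel"
  kappa :: "'a \<Rightarrow> 'a \<Rightarrow> 'k"
  cdim :: "'a \<Rightarrow> nat"

text \<open>Only the values of \<open>kappa\<close> and \<open>cdim\<close> on \<open>cells X\<close> are constrained or used.\<close>

locale cell_complex =
  fixes X :: "('a, 'k::field) cell_structure"
  assumes finite_cells: "finite (cells X)"
    and partial_order: "partial_order_on (cells X) (le X)"
    and dim_mono: "(\<xi>, \<xi>') \<in> le X \<Longrightarrow> cdim X \<xi> \<le> cdim X \<xi>'"
    and kappa_nonzero: "\<lbrakk>\<xi> \<in> cells X; \<xi>' \<in> cells X; kappa X \<xi> \<xi>' \<noteq> 0\<rbrakk>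
           \<Longrightarrow> (\<xi>', \<xi>) \<in> le X \<and> cdim X \<xi> = cdim X \<xi>' + 1"
    and kappa_square: "\<lbrakk>\<xi> \<in> cells X; \<xi>'' \<in> cells X\<rbrakk>
           \<Longrightarrow> (\<Sum>\<xi>'\<in>cells X. kappa X \<xi> \<xi>' * kappa X \<xi>' \<xi>'') = 0"

text \<open>\<open>incident X \<xi>' \<xi>\<close> is \<open>\<xi>' \<prec> \<xi>\<close>: the smaller cell is the first argument here but the
  second argument of \<open>kappa\<close>.\<close>

definition incident :: "('a, 'k::field) cell_structure \<Rightarrow> 'a \<Rightarrow> 'a \<Rightarrow> bool" where
  "incident X \<xi>' \<xi> \<longleftrightarrow> kappa X \<xi> \<xi>' \<noteq> 0"

definition incidence_embedding ::
  "('a, 'k::field) cell_structure \<Rightarrow> ('b, 'l::field) cell_structure \<Rightarrow> ('a \<Rightarrow> 'b) \<Rightarrow> bool" where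
  "incidence_embedding X Y \<iota> \<longleftrightarrow>
     \<iota> \<in> cells X \<rightarrow> cells Y \<and> inj_on \<iota> (cells X) \<and>
     (\<forall>\<xi>\<in>cells X. \<forall>\<xi>'\<in>cells X. incident X \<xi>' \<xi> \<longleftrightarrow> incident Y (\<iota> \<xi>') (\<iota> \<xi>))"

text \<open>Vectors in \<open>\<int>\<^sub>2\<^sup>n\<close> are functions on \<open>{1..n}\<close>, extended by \<open>undefined\<close>.
  The type \<open>bit\<close> is the field \<open>\<int>\<^sub>2\<close> and carries no order, hence the order \<open>0 \<le> 1\<close> and the
  integer sum go through \<open>bit_nat\<close>.\<close>

definition bit_nat :: "bit \<Rightarrow> nat" where
  "bit_nat b = (if b = 1 then 1 else 0)"

definition cube :: "nat \<Rightarrow> (nat \<Rightarrow> bit) set" where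
  "cube n = {1..n} \<rightarrow>\<^sub>E UNIV"

definition cube_le :: "nat \<Rightarrow> (nat \<Rightarrow> bit) rel" where
  "cube_le n = {(x', x). x' \<in> cube n \<and> x \<in> cube n \<and> (\<forall>i\<in>{1..n}. bit_nat (x' i) \<le> bit_nat (x i))}"

definition cube_dim :: "nat \<Rightarrow> (nat \<Rightarrow> bit) \<Rightarrow> nat" where
  "cube_dim n x = (\<Sum>i=1..n. bit_nat (x i))"

definition hypercube :: "nat \<Rightarrow> (nat \<Rightarrow> bit, bit) cell_structure" where
  "hypercube n =
     \<lparr>cells = cube n,
      le = cube_le n,
      kappa = (\<lambda>x x'. if (x', x) \<in> cube_le n \<and> cube_dim n x = cube_dim n x' + 1 then 1 else 0),
      cdim = cube_dim n\<rparr>"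

definition unit_vec :: "nat \<Rightarrow> nat \<Rightarrow> (nat \<Rightarrow> bit)" where
  "unit_vec n i = (\<lambda>j\<in>{1..n}. if j = i then 1 else 0)"

definition template :: "nat \<Rightarrow> nat \<Rightarrow> (nat \<Rightarrow> bit) \<Rightarrow> (nat \<Rightarrow> bit)" where
  "template n i x = (\<lambda>j\<in>{1..n}. x j + unit_vec n i j)"

definition partial_matching :: "('a, 'k::field) cell_structure \<Rightarrow> ('a \<Rightarrow> 'a) \<Rightarrow> bool" where
  "partial_matching X w \<longleftrightarrow>
     w \<in> cells X \<rightarrow> cells X \<and> (\<forall>\<xi>\<in>cells X. w (w \<xi>) = \<xi>) \<and>
     (\<forall>\<xi>\<in>cells X. w \<xi> = \<xi> \<or> incident X \<xi> (w \<xi>) \<or> incident X (w \<xi>) \<xi>)"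

definition matching_Q :: "('a, 'k::field) cell_structure \<Rightarrow> ('a \<Rightarrow> 'a) \<Rightarrow> 'a set" where
  "matching_Q X w = {\<xi> \<in> cells X. incident X \<xi> (w \<xi>)}"

definition matching_rel :: "('a, 'k::field) cell_structure \<Rightarrow> ('a \<Rightarrow> 'a) \<Rightarrow> 'a rel" where
  "matching_rel X w =
     {(\<xi>1, \<xi>0). \<xi>1 \<in> matching_Q X w \<and> \<xi>0 \<in> matching_Q X w \<and> incident X \<xi>1 (w \<xi>0)}"

definition acyclic_partial_matching :: "('a, 'k::field) cell_structure \<Rightarrow> ('a \<Rightarrow> 'a) \<Rightarrow> bool" where
  "acyclic_partial_matching X w \<longleftrightarrow>
     partial_matching X w \<and> partial_order_on (matching_Q X w) ((matching_rel X w)\<^sup>+)"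

text \<open>The sequence \<open>(w\<^sub>1, \<dots>, w\<^sub>n)\<close> is a list, so \<open>w\<^sub>i\<close> is the list entry with index \<open>i - 1\<close>.\<close>

fun mate_helper :: "'a \<Rightarrow> nat \<Rightarrow> ('a \<Rightarrow> 'a) list \<Rightarrow> 'a" where
  "mate_helper \<xi> 0 ws = \<xi>"
| "mate_helper \<xi> (Suc i) ws =
     (let \<xi>' = mate_helper \<xi> i ws
      in if \<xi>' = \<xi> \<and> mate_helper ((ws ! i) \<xi>) i ws = (ws ! i) \<xi> then (ws ! i) \<xi> else \<xi>')"

definition mate :: "'a \<Rightarrow> ('a \<Rightarrow> 'a) list \<Rightarrow> 'a" where
  "mate \<xi> ws = mate_helper \<xi> (length ws) ws"

definition alpha ::
  "('a, 'k::field) cell_structure \<Rightarrow> nat \<Rightarrow> ('a \<Rightarrow> nat \<Rightarrow> bit) \<Rightarrow> nat \<Rightarrow> 'a \<Rightarrow> 'a" where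
  "alpha X n \<iota> i \<xi> =
     (if template n i (\<iota> \<xi>) \<in> \<iota> ` cells X
      then the_inv_into (cells X) \<iota> (template n i (\<iota> \<xi>)) else \<xi>)"

lemma bit_nat_le_iff: "bit_nat a \<le> bit_nat b \<longleftrightarrow> (a = 1 \<longrightarrow> b = 1)"
  by (simp add: bit_nat_def)

lemma finite_cube: "finite (cube n)"
proof -
  have "(UNIV :: bit set) = {0, 1}"
    using bit_not_one_iff by blast
  then have "finite (UNIV :: bit set)"
    by (metis finite.emptyI finite_insert)
  then show ?thesis
    unfolding cube_def by (intro finite_PiE) auto
qed

lemma cube_le_dim_mono: "(x, y) \<in> cube_le n \<Longrightarrow> cube_dim n x \<le> cube_dim n y"
  unfolding cube_le_def cube_dim_def by (auto intro: sum_mono)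

lemma partial_order_cube: "partial_order_on (cube n) (cube_le n)"
proof -
  have "antisym (cube_le n)"
  proof (rule antisymI)
    fix x y assume a: "(x, y) \<in> cube_le n" "(y, x) \<in> cube_le n"
    have "x i = y i" if "i \<in> {1..n}" for i
    proof -
      have "bit_nat (x i) = bit_nat (y i)"
        using a that unfolding cube_le_def by (auto intro!: antisym)
      then show ?thesis
        by (cases "x i"; cases "y i") (auto simp: bit_nat_def)
    qed
    then show "x = y"
      using a unfolding cube_le_def cube_def by (auto intro: PiE_ext)
  qed
  moreover have "trans (cube_le n)"
    by (rule transI) (auto simp: cube_le_def intro: order_trans)
  ultimately show ?thesis
    by (auto simp: partial_order_on_def preorder_on_def refl_on_def cube_le_def)
qed

lemma cell_complex_hypercube: "cell_complex (hypercube n)"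
proof
  show "finite (cells (hypercube n))"
    by (simp add: hypercube_def finite_cube)
  show "partial_order_on (cells (hypercube n)) (le (hypercube n))"
    by (simp add: hypercube_def partial_order_cube)
next
  fix \<xi> \<xi>' assume "(\<xi>, \<xi>') \<in> le (hypercube n)"
  then show "cdim (hypercube n) \<xi> \<le> cdim (hypercube n) \<xi>'"
    by (simp add: hypercube_def cube_le_dim_mono)
next
  fix \<xi> \<xi>'
  assume "kappa (hypercube n) \<xi> \<xi>' \<noteq> 0"
  then show "(\<xi>', \<xi>) \<in> le (hypercube n) \<and> cdim (hypercube n) \<xi> = cdim (hypercube n) \<xi>' + 1"
    by (auto simp: hypercube_def split: if_splits)
next
  fix x z assume "x \<in> cells (hypercube n)" "z \<in> cells (hypercube n)"
  then have xz: "x \<in> cube n" "z \<in> cube n" by (simp_all add: hypercube_def)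
  define P where "P y \<longleftrightarrow> (z, y) \<in> cube_le n \<and> (y, x) \<in> cube_le n \<and>
    cube_dim n x = cube_dim n y + 1 \<and> cube_dim n y = cube_dim n z + 1" for y
  define f :: "_ \<Rightarrow> bit" where "f y = (if P y then 1 else 0)" for y
  have "(\<Sum>y\<in>cube n. f y) = 0"
  proof (cases "\<exists>y. P y")
    case False
    then show ?thesis by (simp add: f_def)
  next
    case True
    then have ne: "x \<noteq> z" and zx: "\<And>j. j \<in> {1..n} \<Longrightarrow> z j = 1 \<Longrightarrow> x j = 1"
      by (auto simp: P_def cube_le_def bit_nat_le_iff)
    then obtain i where i: "i \<in> {1..n}" "x i \<noteq> z i"
      using xz unfolding cube_def by (meson PiE_ext)
    define t where "t y = (\<lambda>j\<in>{1..n}. x j + z j + y j)" for y :: "nat \<Rightarrow> bit"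
    have xzi: "x i + z i = 1" using i(2) by (cases "x i"; cases "z i") auto
    have tcube: "t y \<in> cube n" for y by (simp add: t_def cube_def)
    have tt: "t (t y) = y" if "y \<in> cube n" for y
    proof
      fix j show "t (t y) j = y j"
        using that by (cases "x j"; cases "z j"; cases "y j")
          (auto simp: t_def cube_def PiE_def extensional_def)
    qed
    have ti: "t y i = 1 + y i" for y using xzi i(1) by (simp add: t_def)
    have Pt: "P (t y)" if p: "P y" for y
    proof -
      have le: "\<And>j. j \<in> {1..n} \<Longrightarrow> z j = 1 \<Longrightarrow> y j = 1" "\<And>j. j \<in> {1..n} \<Longrightarrow> y j = 1 \<Longrightarrow> x j = 1"
        using p by (auto simp: P_def cube_le_def bit_nat_le_iff)
      have "bit_nat (t y j) + bit_nat (y j) = bit_nat (x j) + bit_nat (z j)" if "j \<in> {1..n}" for j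
        using le[OF that] that
        by (cases "x j"; cases "z j"; cases "y j") (auto simp: t_def bit_nat_def)
      then have "cube_dim n (t y) + cube_dim n y = cube_dim n x + cube_dim n z"
        unfolding cube_dim_def sum.distrib[symmetric] by (intro sum.cong) auto
      moreover have "z j = 1 \<longrightarrow> t y j = 1" "t y j = 1 \<longrightarrow> x j = 1" if "j \<in> {1..n}" for j
        using le[OF that] that
        by (cases "x j"; cases "z j"; cases "y j"; simp add: t_def)+
      ultimately show ?thesis
        using p xz tcube[of y] by (auto simp: P_def cube_le_def bit_nat_le_iff)
    qed
    have ft: "f (t y) = f y" if "y \<in> cube n" for y
      using Pt[of y] Pt[of "t y"] tt[OF that] by (auto simp: f_def)
    let ?A = "{y \<in> cube n. y i = 0}" and ?B = "{y \<in> cube n. y i = 1}"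
    have "cube n = ?A \<union> ?B" by auto
    then have "(\<Sum>y\<in>cube n. f y) = sum f ?A + sum f ?B"
      using finite_cube by (subst sum.union_disjoint[symmetric]) auto
    also have "sum f ?A = sum f ?B"
      by (rule sum.reindex_bij_witness[where i = t and j = t]) (auto simp: tt ti tcube ft)
    finally show ?thesis by simp
  qed
  moreover have "kappa (hypercube n) x y * kappa (hypercube n) y z = f y" for y
    by (auto simp: hypercube_def f_def P_def)
  ultimately show "(\<Sum>y\<in>cells (hypercube n). kappa (hypercube n) x y * kappa (hypercube n) y z) = 0"
    by (simp add: hypercube_def)
qed

end

theory Submission
  imports Defs
begin

text \<open>
  An incidence embedding into the hypercube labels every incidence \<open>\<xi>' \<prec> \<xi>\<close> by the one coordinate
  at which the images differ, and a step \<open>\<xi>\<^sub>1 \<ll> \<xi>\<^sub>0\<close> becomes: switch one coordinate of \<open>\<xi>\<^sub>0\<close> on,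
  reaching \<open>w \<xi>\<^sub>0\<close>, then switch one coordinate off.  \<open>Mate\<close> is a greedy matching: round by round it
  pairs along one direction those cells that all previous rounds left unmatched.

  Acyclicity rests on one observation.  Suppose that \<open>\<xi>\<^sub>0\<close> and \<open>\<xi>\<^sub>1\<close> are both unmatched before the
  round of direction \<open>d\<close>.  So is the partner \<open>w \<xi>\<^sub>0\<close>.  If the step \<open>\<xi>\<^sub>1 \<ll> \<xi>\<^sub>0\<close> switched \<open>d\<close> off,
  then \<open>\<xi>\<^sub>1\<close> and \<open>w \<xi>\<^sub>0\<close> would be two available cells differing in \<open>d\<close>, this round would match them
  with each other, and \<open>\<xi>\<^sub>1 = \<xi>\<^sub>0\<close> would follow.  Hence coordinate \<open>d\<close> never decreases along
  nontrivial steps \<open>\<xi>\<^sub>1 \<ll> \<xi>\<^sub>0\<close> among cells unmatched before the round (\<open>coordinate_kept\<close>), and it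
  increases whenever \<open>\<xi>\<^sub>0\<close> is matched in this round (\<open>matched_in_round\<close>).  A cycle would therefore
  have to avoid the cells matched in the first round, then those matched in the second round, and
  so on, until no matched cell is left (\<open>wf_matching_rel_unmatched\<close>).

  The argument allows any list of directions.  The single map \<open>\<alpha>\<^sub>i\<close> is \<open>Mate\<close> for the one-element
  list, so both claims are instances of \<open>acyclic_partial_matching_mate_alpha\<close>.
\<close>

section \<open>Greedy combination of involutions\<close>

text \<open>Throughout, the equation \<open>mate_helper \<xi> i ws = \<xi>\<close> expresses that \<open>\<xi>\<close> is still unmatched after
  the first \<open>i\<close> rounds.\<close>

lemma mate_helper_stable:
  assumes "mate_helper \<xi> i ws \<noteq> \<xi>" and "i \<le> j"
  shows "mate_helper \<xi> j ws = mate_helper \<xi> i ws"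
  using assms(2,1) by (induction rule: dec_induct) (auto simp: Let_def)

lemma mate_helper_cases:
  "mate_helper \<xi> i ws = \<xi> \<or> (\<exists>k<i. mate_helper \<xi> i ws = (ws ! k) \<xi>)"
  by (induction i) (auto simp: Let_def less_Suc_eq)

lemma mate_helper_closed:
  assumes "\<And>v. v \<in> set ws \<Longrightarrow> v \<in> A \<rightarrow> A" and "i \<le> length ws" and "\<xi> \<in> A"
  shows "mate_helper \<xi> i ws \<in> A"
  using mate_helper_cases[of \<xi> i ws] assms
  by (metis funcset_mem less_le_trans nth_mem)

text \<open>A round matches two cells only if both are available, so each becomes the
  partner of the other.\<close>

lemma mate_helper_involution:
  assumes closed: "\<And>v. v \<in> set ws \<Longrightarrow> v \<in> A \<rightarrow> A"
    and invol: "\<And>v a. v \<in> set ws \<Longrightarrow> a \<in> A \<Longrightarrow> v (v a) = a"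
    and "i \<le> length ws" and "\<xi> \<in> A"
  shows "mate_helper (mate_helper \<xi> i ws) i ws = \<xi>"
  using assms(3,4)
proof (induction i arbitrary: \<xi>)
  case (Suc i)
  then have IH: "mate_helper (mate_helper \<xi> i ws) i ws = \<xi>"
    and inv: "(ws ! i) ((ws ! i) \<xi>) = \<xi>"
    using invol by auto
  show ?case
  proof (cases "mate_helper \<xi> i ws = \<xi>")
    case True
    then show ?thesis using inv by (auto simp: Let_def)
  next
    case False
    then show ?thesis using IH by (auto simp: Let_def)
  qed
qed simp

lemma partial_matching_mate:
  assumes "\<And>v. v \<in> set ws \<Longrightarrow> partial_matching X v"
  shows "partial_matching X (\<lambda>\<xi>. mate \<xi> ws)"
proof -
  have closed: "\<And>v. v \<in> set ws \<Longrightarrow> v \<in> cells X \<rightarrow> cells X"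
    and invol: "\<And>v a. v \<in> set ws \<Longrightarrow> a \<in> cells X \<Longrightarrow> v (v a) = a"
    using assms by (auto simp: partial_matching_def)
  have "mate \<xi> ws = \<xi> \<or> incident X \<xi> (mate \<xi> ws) \<or> incident X (mate \<xi> ws) \<xi>"
    if "\<xi> \<in> cells X" for \<xi>
    using mate_helper_cases[of \<xi> "length ws" ws] assms that
    unfolding mate_def partial_matching_def by (metis nth_mem)
  then show ?thesis
    using mate_helper_closed[of ws "cells X" "length ws"]
      mate_helper_involution[of ws "cells X" "length ws"] closed invol
    by (auto simp: partial_matching_def mate_def)
qed

section \<open>Incidence in the hypercube\<close>

lemma template_eq_upd:
  assumes "x \<in> cube n" and "i \<in> {1..n}"
  shows "template n i x = x(i := x i + 1)"
  using assms by (auto simp: template_def unit_vec_def cube_def fun_eq_iff restrict_def PiE_def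
      extensional_def)

lemma incident_hypercube_iff:
  assumes x': "x' \<in> cube n" and x: "x \<in> cube n"
  shows "incident (hypercube n) x' x \<longleftrightarrow> (\<exists>i\<in>{1..n}. x' i = 0 \<and> x = x'(i := 1))"
proof
  assume "incident (hypercube n) x' x"
  then have le: "\<And>j. j \<in> {1..n} \<Longrightarrow> bit_nat (x' j) \<le> bit_nat (x j)"
    and dim: "cube_dim n x = cube_dim n x' + 1"
    by (auto simp: incident_def hypercube_def cube_le_def split: if_splits)
  let ?\<delta> = "\<lambda>j. bit_nat (x j) - bit_nat (x' j)"
  have "sum ?\<delta> {1..n} = cube_dim n x - cube_dim n x'"
    unfolding cube_dim_def by (rule sum_subtractf_nat) (rule le)
  with dim have "sum ?\<delta> {1..n} = 1" by linarith
  with sum_eq_1_iff[OF finite_atLeastAtMost]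
  have "\<exists>i\<in>{1..n}. ?\<delta> i = 1 \<and> (\<forall>j\<in>{1..n}. i \<noteq> j \<longrightarrow> ?\<delta> j = 0)"
    by (rule iffD1)
  then obtain i where i: "i \<in> {1..n}" "?\<delta> i = 1"
    and rest: "\<forall>j\<in>{1..n}. i \<noteq> j \<longrightarrow> ?\<delta> j = 0"
    by (elim bexE conjE)
  have xi: "x i = 1" "x' i = 0"
    using i(2) by (auto simp: bit_nat_def split: if_splits)
  have "x j = (x'(i := 1)) j" for j
  proof (cases "j \<in> {1..n}")
    case True
    show ?thesis
    proof (cases "j = i")
      case False
      then have "bit_nat (x j) = bit_nat (x' j)"
        using rest[rule_format, OF True] le[OF True] by simp
      then show ?thesis
        using False by (cases "x j"; cases "x' j") (simp_all add: bit_nat_def)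
    qed (simp add: xi)
  next
    case False
    then show ?thesis
      using x x' i(1) by (auto simp: cube_def PiE_def extensional_def)
  qed
  then show "\<exists>i\<in>{1..n}. x' i = 0 \<and> x = x'(i := 1)"
    using i(1) xi by blast
next
  assume "\<exists>i\<in>{1..n}. x' i = 0 \<and> x = x'(i := 1)"
  then obtain i where i: "i \<in> {1..n}" "x' i = 0" "x = x'(i := 1)" by blast
  have "cube_dim n y = bit_nat (y i) + (\<Sum>j\<in>{1..n} - {i}. bit_nat (y j))" for y
    unfolding cube_dim_def using i(1) by (intro sum.remove) auto
  moreover have "(\<Sum>j\<in>{1..n} - {i}. bit_nat (x j)) = (\<Sum>j\<in>{1..n} - {i}. bit_nat (x' j))"
    using i(3) by (intro sum.cong) auto
  ultimately have "cube_dim n x = cube_dim n x' + 1"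
    using i(2,3) by (simp add: bit_nat_def)
  moreover have "(x', x) \<in> cube_le n"
    using i x x' by (auto simp: cube_le_def bit_nat_def)
  ultimately show "incident (hypercube n) x' x"
    by (simp add: incident_def hypercube_def)
qed

section \<open>Complexes embedded in a hypercube\<close>

locale hypercube_embedded_complex = cell_complex X for X :: "('a, 'k::field) cell_structure" +
  fixes n :: nat and \<iota> :: "'a \<Rightarrow> nat \<Rightarrow> bit"
  assumes embedding: "incidence_embedding X (hypercube n) \<iota>"
begin

lemma inj: "inj_on \<iota> (cells X)"
  using embedding by (simp add: incidence_embedding_def)

lemma image_in_cube: "\<xi> \<in> cells X \<Longrightarrow> \<iota> \<xi> \<in> cube n"
  using embedding by (auto simp: incidence_embedding_def hypercube_def)

lemma incident_iff_upd:
  assumes "\<xi> \<in> cells X" and "\<xi>' \<in> cells X"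
  shows "incident X \<xi>' \<xi> \<longleftrightarrow> (\<exists>i\<in>{1..n}. \<iota> \<xi>' i = 0 \<and> \<iota> \<xi> = (\<iota> \<xi>')(i := 1))"
  using assms embedding incident_hypercube_iff image_in_cube
  by (simp add: incidence_embedding_def)

lemma not_incident_self: "\<xi> \<in> cells X \<Longrightarrow> \<not> incident X \<xi> \<xi>"
  using kappa_nonzero[of \<xi> \<xi>] by (auto simp: incident_def)

lemma alpha_eqI:
  assumes "\<xi> \<in> cells X" "\<eta> \<in> cells X" "d \<in> {1..n}" and "\<iota> \<eta> = (\<iota> \<xi>)(d := \<iota> \<xi> d + 1)"
  shows "alpha X n \<iota> d \<xi> = \<eta>"
proof -
  have "template n d (\<iota> \<xi>) = \<iota> \<eta>"
    using assms template_eq_upd image_in_cube by simp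
  then show ?thesis
    using assms(2) by (simp add: alpha_def the_inv_into_f_f[OF inj])
qed

lemma alpha_cases:
  assumes "\<xi> \<in> cells X" "d \<in> {1..n}"
  obtains "alpha X n \<iota> d \<xi> = \<xi>"
  | "alpha X n \<iota> d \<xi> \<in> cells X" "\<iota> (alpha X n \<iota> d \<xi>) = (\<iota> \<xi>)(d := \<iota> \<xi> d + 1)"
proof (cases "template n d (\<iota> \<xi>) \<in> \<iota> ` cells X")
  case True
  then obtain \<eta> where \<eta>: "\<eta> \<in> cells X" "\<iota> \<eta> = (\<iota> \<xi>)(d := \<iota> \<xi> d + 1)"
    using template_eq_upd[OF image_in_cube[OF assms(1)] assms(2)] by auto
  then show ?thesis
    using alpha_eqI[OF assms(1) \<eta>(1) assms(2) \<eta>(2)] that(2) by simp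
next
  case False
  then show ?thesis using that(1) by (simp add: alpha_def)
qed

lemma partial_matching_alpha:
  assumes d: "d \<in> {1..n}"
  shows "partial_matching X (alpha X n \<iota> d)"
proof -
  let ?\<alpha> = "alpha X n \<iota> d"
  have "?\<alpha> \<xi> \<in> cells X \<and> ?\<alpha> (?\<alpha> \<xi>) = \<xi> \<and>
      (?\<alpha> \<xi> = \<xi> \<or> incident X \<xi> (?\<alpha> \<xi>) \<or> incident X (?\<alpha> \<xi>) \<xi>)"
    if \<xi>: "\<xi> \<in> cells X" for \<xi>
    using \<xi> d
  proof (cases rule: alpha_cases)
    case 1
    then show ?thesis using \<xi> by simp
  next
    case 2
    have "?\<alpha> (?\<alpha> \<xi>) = \<xi>"
      using alpha_eqI[OF 2(1) \<xi> d] 2(2) by (simp add: fun_eq_iff)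
    moreover have "incident X \<xi> (?\<alpha> \<xi>) \<or> incident X (?\<alpha> \<xi>) \<xi>"
    proof (cases "\<iota> \<xi> d")
      case zero
      then show ?thesis
        using incident_iff_upd[OF 2(1) \<xi>] 2(2) d by auto
    next
      case one
      then have "\<iota> \<xi> = (\<iota> (?\<alpha> \<xi>))(d := 1)" "\<iota> (?\<alpha> \<xi>) d = 0"
        using 2(2) by (auto simp: fun_eq_iff)
      then show ?thesis
        using incident_iff_upd[OF \<xi> 2(1)] d by blast
    qed
    ultimately show ?thesis using 2(1) by simp
  qed
  then show ?thesis by (auto simp: partial_matching_def)
qed

end

section \<open>Acyclicity\<close>

locale greedy_direction_matching = hypercube_embedded_complex X n \<iota>
  for X :: "('a, 'k::field) cell_structure" and n :: nat and \<iota> :: "'a \<Rightarrow> nat \<Rightarrow> bit" +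
  fixes ds :: "nat list"
  assumes directions: "set ds \<subseteq> {1..n}"
begin

abbreviation \<alpha>s :: "('a \<Rightarrow> 'a) list" where
  "\<alpha>s \<equiv> map (alpha X n \<iota>) ds"

abbreviation w :: "'a \<Rightarrow> 'a" where
  "w \<equiv> \<lambda>\<xi>. mate \<xi> \<alpha>s"

abbreviation unmatched :: "nat \<Rightarrow> 'a \<Rightarrow> bool" where
  "unmatched m \<xi> \<equiv> mate_helper \<xi> m \<alpha>s = \<xi>"

lemma nth_direction: "m < length ds \<Longrightarrow> ds ! m \<in> {1..n}"
  using directions nth_mem by blast

lemma partial_matching_\<alpha>s: "v \<in> set \<alpha>s \<Longrightarrow> partial_matching X v"
  using directions partial_matching_alpha by auto

lemma partial_matching_w: "partial_matching X w"
  using partial_matching_\<alpha>s by (rule partial_matching_mate)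

lemma w_closed: "\<xi> \<in> cells X \<Longrightarrow> w \<xi> \<in> cells X"
  and w_involution: "\<xi> \<in> cells X \<Longrightarrow> w (w \<xi>) = \<xi>"
  using partial_matching_w by (auto simp: partial_matching_def)

lemma w_eq_mate_helper:
  assumes "\<not> unmatched m \<xi>" and "m \<le> length ds"
  shows "w \<xi> = mate_helper \<xi> m \<alpha>s"
  using mate_helper_stable[OF assms(1), of "length ds"] assms(2) by (simp add: mate_def)

text \<open>If \<open>w \<xi>\<close> had a partner before round \<open>m\<close>, then that partner would be its final one, \<open>\<xi>\<close>.\<close>

lemma unmatched_w:
  assumes "\<xi> \<in> cells X" and "m \<le> length ds" and "unmatched m \<xi>"
  shows "unmatched m (w \<xi>)"
proof (rule ccontr)
  assume neq: "\<not> unmatched m (w \<xi>)"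
  then have "mate_helper (w \<xi>) m \<alpha>s = \<xi>"
    using w_eq_mate_helper assms w_involution by metis
  moreover have "mate_helper (mate_helper (w \<xi>) m \<alpha>s) m \<alpha>s = w \<xi>"
    using partial_matching_\<alpha>s assms(1,2) w_closed
    by (intro mate_helper_involution[where A = "cells X"])
      (simp_all add: partial_matching_def)
  ultimately show False using neq assms(3) by simp
qed

text \<open>Greediness: two available cells that differ in the current direction are matched.\<close>

lemma w_eqI:
  assumes "m < length ds" "\<xi> \<in> cells X" "\<eta> \<in> cells X" "unmatched m \<xi>" "unmatched m \<eta>"
    and "\<iota> \<eta> = (\<iota> \<xi>)(ds ! m := \<iota> \<xi> (ds ! m) + 1)"
  shows "w \<xi> = \<eta>"
proof -
  have "alpha X n \<iota> (ds ! m) \<xi> = \<eta>"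
    using assms nth_direction[OF assms(1)] by (intro alpha_eqI)
  then have step: "mate_helper \<xi> (Suc m) \<alpha>s = \<eta>"
    using assms by simp
  have "\<xi> \<noteq> \<eta>"
    using assms(6) by (metis add_cancel_right_right fun_upd_same zero_neq_one)
  then show ?thesis
    using step w_eq_mate_helper[where m = "Suc m" and \<xi> = \<xi>] assms(1) by simp
qed

lemma w_eq_alpha:
  assumes "m < length ds" "unmatched m \<xi>" "\<not> unmatched (Suc m) \<xi>"
  shows "w \<xi> = alpha X n \<iota> (ds ! m) \<xi>"
  using w_eq_mate_helper[where m = "Suc m" and \<xi> = \<xi>] assms by (auto simp: Let_def split: if_splits)

lemma matching_Q_upd:
  assumes "\<xi> \<in> matching_Q X w"
  obtains k where "\<iota> \<xi> k = 0" "\<iota> (w \<xi>) = (\<iota> \<xi>)(k := 1)"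
  using assms incident_iff_upd w_closed by (auto simp: matching_Q_def)

text \<open>A lower cell matched in round \<open>m\<close> lacks the coordinate of that round, and its partner has it.\<close>

lemma matched_in_round:
  assumes "m < length ds" "\<xi> \<in> matching_Q X w" "unmatched m \<xi>" "\<not> unmatched (Suc m) \<xi>"
  shows "\<iota> \<xi> (ds ! m) = 0" and "\<iota> (w \<xi>) (ds ! m) = 1"
proof -
  have \<xi>: "\<xi> \<in> cells X" "w \<xi> \<noteq> \<xi>"
    using assms(2) not_incident_self by (auto simp: matching_Q_def)
  have "ds ! m \<in> {1..n}" using nth_direction assms(1) .
  with \<xi>(1) have *: "\<iota> (w \<xi>) (ds ! m) = \<iota> \<xi> (ds ! m) + 1"
    by (rule alpha_cases[of \<xi> "ds ! m"]) (use \<xi>(2) w_eq_alpha[OF assms(1,3,4)] in auto)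
  obtain k where k: "\<iota> \<xi> k = 0" "\<iota> (w \<xi>) = (\<iota> \<xi>)(k := 1)"
    using matching_Q_upd[OF assms(2)] .
  with * have "k = ds ! m" by (cases "\<iota> \<xi> (ds ! m)") (auto split: if_splits)
  with k show "\<iota> \<xi> (ds ! m) = 0" "\<iota> (w \<xi>) (ds ! m) = 1" by auto
qed

text \<open>The key point: a step that switched \<open>ds ! m\<close> off would lead from \<open>w \<xi>\<^sub>0\<close> to another available
  cell in direction \<open>ds ! m\<close>, hence to the partner \<open>\<xi>\<^sub>0\<close> of \<open>w \<xi>\<^sub>0\<close>.\<close>

lemma coordinate_kept:
  assumes m: "m < length ds" and step: "(\<xi>1, \<xi>0) \<in> matching_rel X w" "\<xi>1 \<noteq> \<xi>0"
    and free: "unmatched m \<xi>0" "unmatched m \<xi>1"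
  shows "\<iota> \<xi>1 (ds ! m) = \<iota> (w \<xi>0) (ds ! m)"
proof (rule ccontr)
  assume neq: "\<iota> \<xi>1 (ds ! m) \<noteq> \<iota> (w \<xi>0) (ds ! m)"
  have cells: "\<xi>0 \<in> cells X" "\<xi>1 \<in> cells X" "incident X \<xi>1 (w \<xi>0)"
    using step by (auto simp: matching_rel_def matching_Q_def)
  obtain j where j: "\<iota> \<xi>1 j = 0" "\<iota> (w \<xi>0) = (\<iota> \<xi>1)(j := 1)"
    using cells incident_iff_upd w_closed by blast
  then have "ds ! m = j" using neq by (auto split: if_splits)
  then have "w \<xi>1 = w \<xi>0"
    using j cells free m w_closed unmatched_w by (intro w_eqI) auto
  then show False
    using step(2) cells w_involution by metis
qed

text \<open>The steps among cells unmatched before round \<open>m\<close>, read from \<open>\<xi>\<^sub>0\<close> to \<open>\<xi>\<^sub>1\<close>, traverse three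
  classes in order: coordinate \<open>ds ! m\<close> off and not matched in round \<open>m\<close>, matched in round \<open>m\<close>,
  coordinate \<open>ds ! m\<close> on; the measure \<open>f\<close> numbers them 2, 1, 0.  The middle class is left at once, and the cells of the two others are still
  unmatched after the round, so \<open>f\<close> combines lexicographically with the induction hypothesis for \<open>Suc m\<close>.\<close>

lemma wf_matching_rel_unmatched:
  assumes "m \<le> length ds"
  shows "wf {(\<xi>1, \<xi>0) \<in> matching_rel X w. \<xi>1 \<noteq> \<xi>0 \<and> unmatched m \<xi>0 \<and> unmatched m \<xi>1}"
    (is "wf (?R m)")
  using assms
proof (induction rule: inc_induct)
  case base
  \<comment> \<open>A cell unmatched after all rounds is a fixed point of \<open>w\<close>, so it is not incident to its image.\<close>
  have "\<not> unmatched (length ds) \<xi>" if "\<xi> \<in> matching_Q X w" for \<xi>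
    using that not_incident_self[of \<xi>] by (auto simp: matching_Q_def mate_def)
  then have "?R (length ds) = {}"
    by (auto simp: matching_rel_def)
  then show ?case by (simp only: wf_on_bot)
next
  case (step m)
  let ?d = "ds ! m"
  define f :: "'a \<Rightarrow> nat" where
    "f \<xi> = (if \<iota> \<xi> ?d = 1 then 0 else if unmatched (Suc m) \<xi> then 2 else 1)" for \<xi>
  have "?R m \<subseteq> f <*mlex*> ?R (Suc m)"
  proof (rule subrelI)
    fix \<xi>1 \<xi>0 assume r: "(\<xi>1, \<xi>0) \<in> ?R m"
    then have Q: "\<xi>0 \<in> matching_Q X w" "\<xi>1 \<in> matching_Q X w"
      by (auto simp: matching_rel_def)
    have kept: "\<iota> \<xi>1 ?d = \<iota> (w \<xi>0) ?d"
      using r step.hyps by (intro coordinate_kept) auto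
    have mono: "\<iota> (w \<xi>0) ?d = 1" if "\<iota> \<xi>0 ?d = 1"
      using that by (rule_tac matching_Q_upd[OF Q(1)]) auto
    have round0: "\<iota> \<xi>0 ?d = 0 \<and> \<iota> (w \<xi>0) ?d = 1" if "\<not> unmatched (Suc m) \<xi>0"
      using matched_in_round[OF _ Q(1) _ that] r step.hyps by auto
    have round1: "\<iota> \<xi>1 ?d = 0" if "\<not> unmatched (Suc m) \<xi>1"
      using matched_in_round[OF _ Q(2) _ that] r step.hyps by auto
    have "f \<xi>1 < f \<xi>0 \<or> f \<xi>1 = f \<xi>0 \<and> unmatched (Suc m) \<xi>0 \<and> unmatched (Suc m) \<xi>1"
      using kept mono round0 round1 unfolding f_def
      by (cases "unmatched (Suc m) \<xi>0"; cases "unmatched (Suc m) \<xi>1";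
          cases "\<iota> \<xi>0 ?d"; cases "\<iota> \<xi>1 ?d") (simp_all del: mate_helper.simps)
    then show "(\<xi>1, \<xi>0) \<in> f <*mlex*> ?R (Suc m)"
      using r unfolding mlex_prod_def by (auto simp del: mate_helper.simps)
  qed
  then show ?case
    using wf_mlex[OF step.IH] wf_subset by blast
qed

lemma acyclic_partial_matching_mate_alpha: "acyclic_partial_matching X w"
proof -
  let ?Q = "matching_Q X w" and ?R = "matching_rel X w"
  have "wf (?R - Id)"
    using wf_matching_rel_unmatched[of 0] by (rule wf_subset) auto
  then have "antisym ((?R - Id)\<^sup>*)"
    by (intro acyclic_impl_antisym_rtrancl wf_acyclic)
  then have "antisym (?R\<^sup>+)"
    unfolding rtrancl_r_diff_Id by (rule antisym_subset[rotated]) (auto intro: trancl_into_rtrancl)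
  moreover have "refl_on ?Q (?R\<^sup>+)"
    by (auto simp: refl_on_def matching_rel_def matching_Q_def)
  moreover have "?R\<^sup>+ \<subseteq> ?Q \<times> ?Q"
    by (rule trancl_subset_Sigma) (auto simp: matching_rel_def)
  ultimately show ?thesis
    using partial_matching_w
    by (simp add: acyclic_partial_matching_def partial_order_on_def preorder_on_def)
qed

end

theorem theorem1p2:
  fixes X :: "('a, 'k::field) cell_structure"
    and n :: nat
    and \<iota> :: "'a \<Rightarrow> (nat \<Rightarrow> bit)"
  assumes "n \<ge> 1"
    and "cell_complex X"
    and "incidence_embedding X (hypercube n) \<iota>"
  shows "(\<forall>i\<in>{1..n}. acyclic_partial_matching X (alpha X n \<iota> i)) \<and>
         acyclic_partial_matching X (\<lambda>\<xi>. mate \<xi> (map (alpha X n \<iota>) [1..<n+1]))"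
proof -
  have acyclic: "acyclic_partial_matching X (\<lambda>\<xi>. mate \<xi> (map (alpha X n \<iota>) ds))"
    if "set ds \<subseteq> {1..n}" for ds
  proof -
    interpret cell_complex X by fact
    interpret greedy_direction_matching X n \<iota> ds
      by unfold_locales (use assms(3) that in auto)
    show ?thesis by (rule acyclic_partial_matching_mate_alpha)
  qed
  have "(\<lambda>\<xi>. mate \<xi> (map (alpha X n \<iota>) [i])) = alpha X n \<iota> i" for i
    by (auto simp: mate_def fun_eq_iff)
  then have "acyclic_partial_matching X (alpha X n \<iota> i)" if "i \<in> {1..n}" for i
    using acyclic[of "[i]"] that by simp
  then show ?thesis
    using acyclic[of "[1..<n+1]"] by (simp add: atLeastLessThanSuc_atLeastAtMost del: upt_Suc)
qed

end
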